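(* Let $H$ be a graph, let $P_3$ be the path on three vertices, and let $G=H\wedge P_3$ be the Kronecker product. Then $G$ is not $3$-polytopal.
   Context: All graphs are finite and simple. The Kronecker (direct) product $H\wedge J$ of graphs $H,J$ has vertex set $V(H)\times V(J)$ and edge set $\{(a,x)(b,y) : ab\in E(H) \text{ and } xy\in E(J)\}$. For $k\ge 1$, a graph $G$ is $k$-connected if $|V(G)|>k$ and the removal of any fewer than $k$ vertices leaves a connected graph. A graph is $3$-polytopal (is a $3$-polytope) if it is planar and $3$-connected. *)

theory Defs
  imports "HOL-Analysis.Path_Connected" "Graph_Theory.Digraph_Component"
begin

text \<open>Finite simple graphs are the symmetric loop-free pair digraphs, i.e. the locale
  \<^locale>\<open>pair_graph\<close>: an undirected edge \<open>uv\<close> is the pair of arcs \<open>(u,v)\<close>, \<open>(v,u)\<close>.\<close>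

definition path_graph :: "nat \<Rightarrow> nat pair_pre_digraph" where
  "path_graph n = \<lparr> pverts = {..<n},
     parcs = {(i, j). i < n \<and> j < n \<and> (j = Suc i \<or> i = Suc j)} \<rparr>"

definition kronecker ::
    "'a pair_pre_digraph \<Rightarrow> 'b pair_pre_digraph \<Rightarrow> ('a \<times> 'b) pair_pre_digraph" (infixr "\<otimes>\<^sub>K" 70) where
  "H \<otimes>\<^sub>K J = \<lparr> pverts = pverts H \<times> pverts J,
     parcs = {((a, x), (b, y)) | a x b y. (a, b) \<in> parcs H \<and> (x, y) \<in> parcs J} \<rparr>"

text \<open>Meaningful for \<open>k \<ge> 1\<close>. The name \<open>connected\<close> alone would be ambiguous with
  topological connectedness.\<close>

definition k_connected :: "nat \<Rightarrow> 'a pair_pre_digraph \<Rightarrow> bool" where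
  "k_connected k G \<longleftrightarrow> k < card (pverts G) \<and>
     (\<forall>S \<subseteq> pverts G. card S < k \<longrightarrow>
        Digraph_Component.connected (with_proj G \<restriction> (pverts G - S)))"

text \<open>A drawing places vertices at distinct points of the plane (taken to be the complex plane)
  and draws each undirected edge as one simple arc between its two ends, hence \<open>c\<close> is indexed by
  the two-element set \<open>{u, v}\<close>. Arcs run through no other vertex, and two different edges share
  at most points that are vertices, which are then common ends.\<close>

definition plane_drawing ::
    "'a pair_pre_digraph \<Rightarrow> ('a \<Rightarrow> complex) \<Rightarrow> ('a set \<Rightarrow> real \<Rightarrow> complex) \<Rightarrow> bool" where
  "plane_drawing G p c \<longleftrightarrow>
     inj_on p (pverts G) \<and>
     (\<forall>(u, v) \<in> parcs G.
        Path_Connected.arc (c {u, v}) \<and>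
        {pathstart (c {u, v}), pathfinish (c {u, v})} = {p u, p v} \<and>
        path_image (c {u, v}) \<inter> p ` pverts G = {p u, p v}) \<and>
     (\<forall>(u, v) \<in> parcs G. \<forall>(w, z) \<in> parcs G. {u, v} \<noteq> {w, z} \<longrightarrow>
        path_image (c {u, v}) \<inter> path_image (c {w, z}) \<subseteq> p ` pverts G)"

definition planar :: "'a pair_pre_digraph \<Rightarrow> bool" where
  "planar G \<longleftrightarrow> (\<exists>p c. plane_drawing G p c)"

definition polytopal3 :: "'a pair_pre_digraph \<Rightarrow> bool" where
  "polytopal3 G \<longleftrightarrow> planar G \<and> k_connected 3 G"

lemma pair_graph_path_graph: "pair_graph (path_graph n)"
proof -
  have "finite (parcs (path_graph n))"
    by (rule finite_subset[of _ "{..<n} \<times> {..<n}"]) (auto simp: path_graph_def)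
  then show ?thesis
    by unfold_locales (auto simp: path_graph_def symmetric_def sym_def)
qed

lemma pair_graph_kronecker:
  assumes "pair_graph H" "pair_graph J"
  shows "pair_graph (H \<otimes>\<^sub>K J)"
proof -
  interpret H: pair_graph H by fact
  interpret J: pair_graph J by fact
  have "parcs (H \<otimes>\<^sub>K J) \<subseteq> (pverts H \<times> pverts J) \<times> (pverts H \<times> pverts J)"
    by (auto simp: kronecker_def dest: H.wellformed' J.wellformed')
  then have "finite (parcs (H \<otimes>\<^sub>K J))"
    by (rule finite_subset) (simp add: H.pair_finite_verts J.pair_finite_verts)
  then show ?thesis
    by unfold_locales
      (auto simp: kronecker_def symmetric_def sym_def H.pair_finite_verts J.pair_finite_verts
        dest: H.wellformed' J.wellformed' H.no_loops' J.no_loops' H.arcs_symmetric J.arcs_symmetric)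
qed

end

theory Submission
  imports Defs "HOL-Complex_Analysis.Winding_Numbers"
begin

text \<open>
  If \<open>a\<close> is a vertex of \<open>H\<close>, then \<open>(a, 0)\<close> and \<open>(a, 2)\<close> have the same neighbours in
  \<open>H \<otimes>\<^sub>K path_graph 3\<close>, namely the pairs \<open>(b, 1)\<close> with \<open>ab\<close> an edge of \<open>H\<close>, whereas the
  vertex \<open>(a, 1)\<close> is not one of these neighbours. A planar 3-connected graph cannot contain such a
  configuration (\<open>planar_3_connected_twins_dominate\<close>).

  Let \<open>a\<close>, \<open>a'\<close> be two vertices with the same neighbourhood, and let \<open>r\<close> be a third vertex outside
  that neighbourhood. Delete the two twins and all their neighbours, and let \<open>C\<close> be the
  component of \<open>r\<close> in what remains. The set \<open>N\<close> of the vertices outside \<open>C\<close> that are adjacent to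
  \<open>C\<close> consists of common neighbours of the twins, and it separates \<open>r\<close> from \<open>a\<close>, so
  3-connectedness gives three different members of \<open>N\<close>. Each of them is adjacent to
  \<open>a\<close>, to \<open>a'\<close> and to the connected set \<open>C\<close>: contracting \<open>C\<close> exhibits \<open>K\<^sub>3\<^sub>,\<^sub>3\<close> as a minor.

  That such a minor cannot be drawn (\<open>no_plane_K33_model\<close>) is shown without contracting anything.
  In a drawing the three paths from \<open>a\<close> to \<open>a'\<close> through the chosen members of \<open>N\<close> form a theta
  curve, that is, three arcs that have only their ends in common. The drawing of \<open>C\<close> together with
  the edges that leave it is a connected set off the theta curve which has an interior
  point of each of the three arcs in its closure. But every region of the complement of a theta
  curve has only two of the three arcs on its boundary (\<open>theta_curve_no_common_side\<close>). This last
  fact follows from the Jordan curve theorem, together with the observation that the winding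
  numbers of the three loops formed by the arcs, suitably oriented, add up to zero.
\<close>

section \<open>Theta curves in the plane\<close>

definition theta_curve :: "complex \<Rightarrow> complex \<Rightarrow> (real \<Rightarrow> complex) \<Rightarrow> (real \<Rightarrow> complex) \<Rightarrow>
    (real \<Rightarrow> complex) \<Rightarrow> bool" where
  "theta_curve a b f g h \<longleftrightarrow>
     (\<forall>k \<in> {f, g, h}. Path_Connected.arc k \<and> pathstart k = a \<and> pathfinish k = b) \<and>
     path_image f \<inter> path_image g = {a, b} \<and>
     path_image f \<inter> path_image h = {a, b} \<and>
     path_image g \<inter> path_image h = {a, b}"

lemma theta_curve_rotate: "theta_curve a b f g h \<Longrightarrow> theta_curve a b g h f"
  by (auto simp: theta_curve_def Int_commute)

lemma theta_curve_loop:
  assumes "theta_curve a b f g h"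
  shows "simple_path (f +++ reversepath g)"
    and "pathfinish (f +++ reversepath g) = pathstart (f +++ reversepath g)"
    and "path_image (f +++ reversepath g) = path_image f \<union> path_image g"
proof -
  show "simple_path (f +++ reversepath g)"
    using assms by (intro simple_path_join_loop) (auto simp: theta_curve_def arc_reversepath)
qed (use assms in \<open>auto simp: theta_curve_def path_image_join\<close>)

lemma theta_curve_Jordan:
  assumes "theta_curve a b f g h"
  defines "S \<equiv> path_image f \<union> path_image g"
  shows "inside S \<noteq> {}" "open (inside S)" "Topological_Spaces.connected (inside S)"
    "Topological_Spaces.connected (outside S)" "bounded (inside S)" "\<not> bounded (outside S)"
    "frontier (inside S) = S" "frontier (outside S) = S"
  using Jordan_inside_outside[OF theta_curve_loop(1,2)[OF assms(1)]]
  unfolding theta_curve_loop(3)[OF assms(1)] S_def by auto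

lemma connected_subset_inside:
  fixes S T :: "complex set"
  assumes "Topological_Spaces.connected T" "T \<inter> S = {}" "x \<in> T" "x \<in> inside S"
  shows "T \<subseteq> inside S"
proof
  fix y assume "y \<in> T"
  then have "connected_component (- S) x y"
    using assms unfolding connected_component_def by blast
  then show "y \<in> inside S"
    using assms(4) inside_same_component by blast
qed

lemma theta_curve_arc_inside:
  assumes \<theta>: "theta_curve a b f g h"
    and x: "x \<in> path_image h" "x \<in> inside (path_image f \<union> path_image g)"
  shows "path_image h - {a, b} \<subseteq> inside (path_image f \<union> path_image g)"
proof -
  have "Topological_Spaces.connected (path_image h - {a, b})"
    using \<theta> connected_simple_path_endless[of h] by (auto simp: theta_curve_def arc_imp_simple_path)
  moreover have "(path_image h - {a, b}) \<inter> (path_image f \<union> path_image g) = {}"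
    using \<theta> unfolding theta_curve_def by blast
  moreover have "{a, b} \<subseteq> path_image f"
    using \<theta> unfolding theta_curve_def by blast
  then have "x \<in> path_image h - {a, b}"
    using x inside_no_overlap[of "path_image f \<union> path_image g"] by blast
  ultimately show ?thesis
    using connected_subset_inside x(2) by blast
qed

text \<open>
  This translates insideness into an equation between the winding numbers of the single arcs, which
  are not closed: the winding number of the loop is their difference, and it is \<open>1\<close> or \<open>-1\<close> inside
  the loop and \<open>0\<close> outside.
\<close>

lemma theta_curve_winding:
  assumes "theta_curve a b f g h" "z \<notin> path_image f \<union> path_image g"
  shows "z \<in> inside (path_image f \<union> path_image g) \<longleftrightarrow> winding_number f z \<noteq> winding_number g z"
proof -
  let ?l = "f +++ reversepath g"
  have [simp]: "path f" "path g"
    using assms(1) by (auto simp: theta_curve_def arc_imp_path)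
  have w: "winding_number ?l z = winding_number f z - winding_number g z"
    using assms by (subst winding_number_join) (auto simp: theta_curve_def winding_number_reversepath)
  show ?thesis
  proof (cases "z \<in> inside (path_image f \<union> path_image g)")
    case True
    then have "norm (winding_number ?l z) = 1"
      using simple_closed_path_norm_winding_number_inside theta_curve_loop(1,3)[OF assms(1)]
      by metis
    then show ?thesis using True w by auto
  next
    case False
    then have "z \<in> outside (path_image ?l)"
      using assms(2) inside_Un_outside theta_curve_loop(3)[OF assms(1)] by (metis ComplI UnE)
    then have "winding_number ?l z = 0"
      using theta_curve_loop(1,2)[OF assms(1)] winding_number_zero_in_outside simple_path_imp_path
      by blast
    then show ?thesis using False w by auto
  qed
qed

text \<open>
  By the preceding lemma, \<open>z\<close> lies inside exactly those loops whose two arcs have different winding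
  numbers about \<open>z\<close>. If two numbers differ, then a third number differs from at least one of them.
\<close>

lemma theta_curve_inside_two:
  assumes "theta_curve a b f g h" "z \<notin> path_image h"
    and "z \<in> inside (path_image f \<union> path_image g)"
  shows "z \<in> inside (path_image g \<union> path_image h) \<or> z \<in> inside (path_image h \<union> path_image f)"
proof -
  have z: "z \<notin> path_image f \<union> path_image g"
    using assms(3) inside_no_overlap by blast
  show ?thesis
    using theta_curve_winding[of a b f g h z] theta_curve_winding[of a b g h f z]
      theta_curve_winding[of a b h f g z] assms z theta_curve_rotate by (metis Un_iff)
qed

text \<open>
  A connected set \<open>T\<close> that reaches the third arc lies on the same side of the loop formed by the
  other two as that arc does.
\<close>

lemma theta_curve_side:
  assumes \<theta>: "theta_curve a b f g h"
    and T: "Topological_Spaces.connected T" "x \<in> T" "T \<inter> (path_image f \<union> path_image g) = {}"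
    and r: "r \<in> path_image h - {a, b}" "r \<in> closure T"
  shows "x \<in> inside (path_image f \<union> path_image g) \<longleftrightarrow> r \<in> inside (path_image f \<union> path_image g)"
proof -
  have c: "Topological_Spaces.connected (insert r T)"
    using connected_intermediate_closure[OF T(1), of "insert r T"] r closure_subset by auto
  have d: "insert r T \<inter> (path_image f \<union> path_image g) = {}"
    using T(3) r(1) \<theta> unfolding theta_curve_def by blast
  show ?thesis
    using connected_subset_inside[OF c d] T(2) by blast
qed

text \<open>
  If \<open>h\<close> runs inside the loop of \<open>f\<close> and \<open>g\<close>, then the unbounded outside of that loop avoids
  \<open>g\<close> and \<open>h\<close>. It accumulates at every point of \<open>f\<close>, so if such a point lay inside the loop of \<open>g\<close>
  and \<open>h\<close>, then that inside would contain the whole outside of the first loop and could not be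
  bounded.
\<close>

lemma theta_curve_not_mutually_inside:
  assumes \<theta>: "theta_curve a b f g h"
    and t: "t \<in> path_image h" "t \<in> inside (path_image f \<union> path_image g)"
    and r: "r \<in> path_image f" "r \<in> inside (path_image g \<union> path_image h)"
  shows False
proof -
  let ?O = "outside (path_image f \<union> path_image g)" and ?I = "inside (path_image g \<union> path_image h)"
  note J = theta_curve_Jordan[OF \<theta>] and J' = theta_curve_Jordan[OF theta_curve_rotate[OF \<theta>]]
  have "r \<in> closure ?O"
    using J(8) r(1) by (auto simp: frontier_def)
  then obtain x where x: "x \<in> ?O" "x \<in> ?I"
    using J'(2) r(2) open_Int_closure_eq_empty[of ?I ?O] by blast
  have ab: "{a, b} \<subseteq> path_image g"
    using \<theta> unfolding theta_curve_def by blast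
  then have "path_image h \<subseteq> inside (path_image f \<union> path_image g) \<union> path_image g"
    using theta_curve_arc_inside[OF \<theta> t] by blast
  then have "?O \<inter> (path_image g \<union> path_image h) = {}"
    using outside_no_overlap[of "path_image f \<union> path_image g"]
      inside_Int_outside[of "path_image f \<union> path_image g"] by blast
  then have "?O \<subseteq> ?I"
    using connected_subset_inside J(4) x by blast
  then show False
    using J(6) J'(5) bounded_subset by blast
qed

text \<open>
  The inside of the loop of \<open>f\<close> and \<open>g\<close> is connected and, as \<open>h\<close> stays out of it, disjoint from
  the whole theta curve. If it met the inside of the loop of \<open>g\<close> and \<open>h\<close>, it would be contained in it,
  and the boundary arc \<open>f\<close> would be in the closure of the latter, which adds only \<open>g\<close> and \<open>h\<close>.
\<close>

lemma theta_curve_insides_disjoint: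
  assumes \<theta>: "theta_curve a b f g h"
    and t: "t \<in> path_image h - {a, b}" "t \<notin> inside (path_image f \<union> path_image g)"
    and r: "r \<in> path_image f - {a, b}" "r \<notin> inside (path_image g \<union> path_image h)"
  shows "inside (path_image f \<union> path_image g) \<inter> inside (path_image g \<union> path_image h) = {}"
    (is "?I \<inter> ?I' = {}")
proof (rule ccontr)
  assume "?I \<inter> ?I' \<noteq> {}"
  then obtain x where x: "x \<in> ?I" "x \<in> ?I'" by blast
  note J = theta_curve_Jordan[OF \<theta>] and J' = theta_curve_Jordan[OF theta_curve_rotate[OF \<theta>]]
  have "?I \<inter> path_image h = {}"
    using theta_curve_arc_inside[OF \<theta>] t by blast
  then have "?I \<inter> (path_image g \<union> path_image h) = {}"
    using inside_no_overlap[of "path_image f \<union> path_image g"] by blast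
  then have "?I \<subseteq> ?I'"
    using connected_subset_inside J(3) x by blast
  moreover have "r \<in> closure ?I"
    using J(7) r(1) by (auto simp: frontier_def)
  ultimately have "r \<in> closure ?I'"
    using closure_mono by blast
  then have "r \<in> path_image g \<union> path_image h"
    using J'(7) r(2) closure_Un_frontier by blast
  then show False
    using \<theta> r(1) unfolding theta_curve_def by blast
qed

text \<open>
  Each arc lies on the same side of the loop of the other two as \<open>D\<close> does. If \<open>D\<close> were inside some
  loop, it would be inside a second one, and the two arcs opposite to these loops would run inside
  them, which is impossible. So no arc runs inside the loop of the other two; but then the
  insides of the three loops are pairwise disjoint, although every point inside one of them and
  off the third arc is inside another.
\<close>

theorem theta_curve_no_common_side:
  assumes \<theta>: "theta_curve a b f g h"
    and D: "Topological_Spaces.connected D" "D \<inter> (path_image f \<union> path_image g \<union> path_image h) = {}"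
    and r: "r \<in> path_image f - {a, b}" and s: "s \<in> path_image g - {a, b}"
    and t: "t \<in> path_image h - {a, b}"
    and cl: "{r, s, t} \<subseteq> closure D"
  shows False
proof -
  let ?fg = "path_image f \<union> path_image g" and ?gh = "path_image g \<union> path_image h"
    and ?hf = "path_image h \<union> path_image f"
  have \<theta>': "theta_curve a b g h f" "theta_curve a b h f g"
    using \<theta> theta_curve_rotate by blast+
  have "D \<noteq> {}" using cl by auto
  then obtain d where d: "d \<in> D" by blast
  have D': "D \<inter> ?fg = {}" "D \<inter> ?gh = {}" "D \<inter> ?hf = {}" "d \<notin> path_image f" "d \<notin> path_image g"
    "d \<notin> path_image h"
    using D(2) d by blast+
  have "t \<in> closure D" "r \<in> closure D" "s \<in> closure D" using cl by auto
  then have side: "d \<in> inside ?fg \<longleftrightarrow> t \<in> inside ?fg" "d \<in> inside ?gh \<longleftrightarrow> r \<in> inside ?gh"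
    "d \<in> inside ?hf \<longleftrightarrow> s \<in> inside ?hf"
    using theta_curve_side[OF \<theta> D(1) d D'(1) t] theta_curve_side[OF \<theta>'(1) D(1) d D'(2) r]
      theta_curve_side[OF \<theta>'(2) D(1) d D'(3) s] by simp_all
  have "\<not> (d \<in> inside ?fg \<and> d \<in> inside ?gh)"
    using theta_curve_not_mutually_inside[OF \<theta>, of t r] side r t by blast
  moreover have "\<not> (d \<in> inside ?gh \<and> d \<in> inside ?hf)"
    using theta_curve_not_mutually_inside[OF \<theta>'(1), of r s] side r s by blast
  moreover have "\<not> (d \<in> inside ?hf \<and> d \<in> inside ?fg)"
    using theta_curve_not_mutually_inside[OF \<theta>'(2), of s t] side s t by blast
  ultimately have "d \<notin> inside ?fg" "d \<notin> inside ?gh" "d \<notin> inside ?hf"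
    using theta_curve_inside_two[OF \<theta>] theta_curve_inside_two[OF \<theta>'(1)]
      theta_curve_inside_two[OF \<theta>'(2)] D' by blast+
  then have out: "t \<notin> inside ?fg" "r \<notin> inside ?gh" "s \<notin> inside ?hf"
    using side by blast+
  obtain x where x: "x \<in> inside ?fg"
    using theta_curve_Jordan(1)[OF \<theta>] by blast
  have "x \<notin> path_image h"
    using theta_curve_arc_inside[OF \<theta> _ x] t out(1) by blast
  then consider "x \<in> inside ?gh" | "x \<in> inside ?hf"
    using theta_curve_inside_two[OF \<theta> _ x] by blast
  then show False
  proof cases
    case 1
    then show False
      using theta_curve_insides_disjoint[OF \<theta> t out(1) r out(2)] x by blast
  next
    case 2
    then show False
      using theta_curve_insides_disjoint[OF \<theta>'(2) s out(3) t out(1)] x by blast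
  qed
qed

section \<open>Drawings of graphs\<close>

lemma plane_drawingD:
  assumes "plane_drawing G p c"
  shows "inj_on p (pverts G)"
    and "(u, v) \<in> parcs G \<Longrightarrow> Path_Connected.arc (c {u, v})"
    and "(u, v) \<in> parcs G \<Longrightarrow> {pathstart (c {u, v}), pathfinish (c {u, v})} = {p u, p v}"
    and "(u, v) \<in> parcs G \<Longrightarrow> path_image (c {u, v}) \<inter> p ` pverts G = {p u, p v}"
    and "(u, v) \<in> parcs G \<Longrightarrow> (w, z) \<in> parcs G \<Longrightarrow> {u, v} \<noteq> {w, z} \<Longrightarrow>
      path_image (c {u, v}) \<inter> path_image (c {w, z}) \<subseteq> p ` pverts G"
proof -
  from assms have 1: "inj_on p (pverts G)"
    and 2: "\<forall>(u, v) \<in> parcs G. Path_Connected.arc (c {u, v}) \<and>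
      {pathstart (c {u, v}), pathfinish (c {u, v})} = {p u, p v} \<and>
      path_image (c {u, v}) \<inter> p ` pverts G = {p u, p v}"
    and 3: "\<forall>(u, v) \<in> parcs G. \<forall>(w, z) \<in> parcs G. {u, v} \<noteq> {w, z} \<longrightarrow>
      path_image (c {u, v}) \<inter> path_image (c {w, z}) \<subseteq> p ` pverts G"
    unfolding plane_drawing_def by simp_all
  show "inj_on p (pverts G)" by (rule 1)
  show "Path_Connected.arc (c {u, v})" "{pathstart (c {u, v}), pathfinish (c {u, v})} = {p u, p v}"
    "path_image (c {u, v}) \<inter> p ` pverts G = {p u, p v}" if "(u, v) \<in> parcs G"
    using bspec[OF 2 that] by simp_all
  show "path_image (c {u, v}) \<inter> path_image (c {w, z}) \<subseteq> p ` pverts G"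
    if "(u, v) \<in> parcs G" "(w, z) \<in> parcs G" "{u, v} \<noteq> {w, z}"
    using bspec[OF 3 that(1)] that(2,3) by auto
qed

text \<open>
  The arc of an edge is indexed by the unordered pair of its ends, so its direction is unknown;
  \<open>g\<close> is this arc or its reversal.
\<close>

lemma plane_drawing_edge:
  assumes "plane_drawing G p c" "(u, v) \<in> parcs G"
  obtains g where "Path_Connected.arc g" "pathstart g = p u" "pathfinish g = p v"
    "path_image g = path_image (c {u, v})" "path_image g \<inter> p ` pverts G = {p u, p v}"
proof -
  let ?e = "c {u, v}"
  have e: "Path_Connected.arc ?e" "{pathstart ?e, pathfinish ?e} = {p u, p v}"
    "path_image ?e \<inter> p ` pverts G = {p u, p v}"
    using plane_drawingD(2-4)[OF assms] by simp_all
  show thesis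
  proof (cases "pathstart ?e = p u \<and> pathfinish ?e = p v")
    case True
    then show thesis using that[of ?e] e by auto
  next
    case False
    then have "pathstart ?e = p v" "pathfinish ?e = p u"
      using e(2) by (auto simp: doubleton_eq_iff)
    then show thesis using that[of "reversepath ?e"] e by (auto simp: arc_reversepath)
  qed
qed

lemma plane_drawing_edges_meet:
  assumes d: "plane_drawing G p c" and G: "pair_graph G"
    and e: "(u, v) \<in> parcs G" "(w, z) \<in> parcs G" "{u, v} \<noteq> {w, z}"
  shows "path_image (c {u, v}) \<inter> path_image (c {w, z}) = p ` ({u, v} \<inter> {w, z})"
proof -
  interpret pair_graph G by fact
  have V: "u \<in> pverts G" "v \<in> pverts G" "w \<in> pverts G" "z \<in> pverts G"
    using e(1,2) by (auto dest: wellformed')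
  have inj: "inj_on p (pverts G)"
    using d by (rule plane_drawingD)
  have "path_image (c {u, v}) \<inter> path_image (c {w, z}) \<subseteq> p ` pverts G"
    using d e by (rule plane_drawingD)
  moreover have "path_image (c {u, v}) \<inter> p ` pverts G = p ` {u, v}"
    "path_image (c {w, z}) \<inter> p ` pverts G = p ` {w, z}"
    using plane_drawingD(4)[OF d] e by simp_all
  ultimately have "path_image (c {u, v}) \<inter> path_image (c {w, z}) = p ` {u, v} \<inter> p ` {w, z}"
    by blast
  also have "\<dots> = p ` ({u, v} \<inter> {w, z})"
    using inj_on_image_Int[OF inj, of "{u, v}" "{w, z}"] V by auto
  finally show ?thesis .
qed

lemma connected_arc_delete_end:
  fixes g :: "real \<Rightarrow> 'a::metric_space"
  assumes "Path_Connected.arc g"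
  shows "Topological_Spaces.connected (path_image g - {pathfinish g})"
    and "pathfinish g \<in> closure (path_image g - {pathfinish g})"
proof -
  have g: "continuous_on {0..1} g" "inj_on g {0..1}"
    using assms by (auto simp: arc_def path_def)
  have "{0..1} = insert (1::real) {0..<1}" by auto
  then have "path_image g = insert (pathfinish g) (g ` {0..<1})"
    by (simp add: path_image_def pathfinish_def)
  moreover have "pathfinish g \<notin> g ` {0..<1}"
    using g(2) by (auto simp: pathfinish_def dest: inj_onD)
  ultimately have "path_image g - {pathfinish g} = g ` {0..<1}" by simp
  moreover have "Topological_Spaces.connected (g ` {0..<1})"
    using g(1) by (intro connected_continuous_image) (auto intro: continuous_on_subset)
  ultimately show "Topological_Spaces.connected (path_image g - {pathfinish g})"
    by simp
  have "path_image g \<noteq> {x}" for x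
    using arc_distinct_ends[OF assms] pathstart_in_path_image[of g] pathfinish_in_path_image[of g]
    by auto
  then have "pathfinish g islimpt path_image g"
    using connected_imp_perfect[of "path_image g"] connected_arc_image[OF assms] by blast
  then show "pathfinish g \<in> closure (path_image g - {pathfinish g})"
    by (simp add: islimpt_in_closure)
qed

text \<open>
  The drawn subgraph induced by \<open>C\<close>, together with the edges leaving \<open>C\<close>, each without its end
  outside \<open>C\<close>. In the drawing this set takes the place of the vertex that arises by contracting \<open>C\<close>.
  The points \<open>p ` C\<close> are listed separately for the sake of vertices without neighbours.
\<close>

definition open_star :: "'a pair_pre_digraph \<Rightarrow> ('a \<Rightarrow> complex) \<Rightarrow> ('a set \<Rightarrow> real \<Rightarrow> complex) \<Rightarrow>
    'a set \<Rightarrow> complex set" where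
  "open_star G p c C =
     (p ` C \<union> (\<Union>(u, v) \<in> parcs G \<inter> C \<times> UNIV. path_image (c {u, v}))) - p ` (pverts G - C)"

lemma open_star_half_edge:
  assumes d: "plane_drawing G p c" and G: "pair_graph G"
    and C: "C \<subseteq> pverts G" "u \<in> C" and e: "(u, v) \<in> parcs G"
  obtains T where "T = path_image (c {u, v}) - p ` (pverts G - C)"
    "Topological_Spaces.connected T" "p u \<in> T" "T \<subseteq> open_star G p c C" "p v \<in> closure T"
proof -
  interpret pair_graph G by fact
  let ?T = "path_image (c {u, v}) - p ` (pverts G - C)"
  have v: "v \<in> pverts G" "u \<in> pverts G" "u \<noteq> v"
    using e by (auto dest: wellformed' no_loops')
  have inj: "inj_on p (pverts G)"
    using d by (rule plane_drawingD)
  obtain g where g: "Path_Connected.arc g" "pathstart g = p u" "pathfinish g = p v"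
    "path_image g = path_image (c {u, v})" "path_image g \<inter> p ` pverts G = {p u, p v}"
    using plane_drawing_edge[OF d e] .
  have pu: "p u \<notin> p ` (pverts G - C)"
    using inj C v by (auto simp: inj_on_def)
  have T: "?T = path_image g - (if v \<in> C then {} else {p v})"
  proof -
    have "p v \<in> p ` (pverts G - C) \<longleftrightarrow> v \<notin> C"
      using inj C v by (auto simp: inj_on_def)
    moreover have "path_image g \<inter> p ` (pverts G - C) = {p u, p v} \<inter> p ` (pverts G - C)"
      using g(5) by blast
    then have "path_image g - p ` (pverts G - C) = path_image g - {p u, p v} \<inter> p ` (pverts G - C)"
      by blast
    ultimately show ?thesis
      using g(4) pu by auto
  qed
  show thesis
  proof (rule that[OF refl])
    show "Topological_Spaces.connected ?T"
      using T g(3,4) connected_arc_image[OF g(1)] connected_arc_delete_end(1)[OF g(1)]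
      by (auto split: if_splits)
    show "p u \<in> ?T"
      using pu g pathstart_in_path_image[of g] by auto
    show "?T \<subseteq> open_star G p c C"
      using e C(2) unfolding open_star_def by blast
    show "p v \<in> closure ?T"
      using T g connected_arc_delete_end(2)[OF g(1)] closure_subset[of ?T]
        pathfinish_in_path_image[of g] by (auto split: if_splits)
  qed
qed

lemma connected_open_star:
  assumes d: "plane_drawing G p c" and G: "pair_graph G"
    and C: "C \<subseteq> pverts G" "\<And>v. v \<in> C \<Longrightarrow> (r, v) \<in> (parcs G \<inter> C \<times> C)\<^sup>*"
  shows "Topological_Spaces.connected (open_star G p c C)"
proof -
  let ?D = "open_star G p c C"
  have inj: "inj_on p (pverts G)"
    using d by (rule plane_drawingD)
  have pC: "p v \<in> ?D" if "v \<in> C" for v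
    using that C(1) inj unfolding open_star_def by (auto simp: inj_on_def)
  have vert: "connected_component ?D (p r) (p v)" if v: "v \<in> C" for v
  proof -
    have "v \<in> C \<longrightarrow> connected_component ?D (p r) (p v)"
      using C(2)[OF v]
    proof (induction rule: rtrancl_induct)
      case base
      then show ?case using pC by simp
    next
      case (step w z)
      then have wz: "w \<in> C" "z \<in> C" "(w, z) \<in> parcs G" by auto
      obtain T where T: "T = path_image (c {w, z}) - p ` (pverts G - C)"
        "Topological_Spaces.connected T" "p w \<in> T" "T \<subseteq> ?D"
        using open_star_half_edge[OF d G C(1) wz(1,3)] by blast
      have "p z \<in> path_image (c {w, z})"
        using plane_drawingD(4)[OF d wz(3)] by blast
      then have "p z \<in> T"
        using T(1) pC[OF wz(2)] unfolding open_star_def by blast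
      then have "connected_component ?D (p w) (p z)"
        using T unfolding connected_component_def by blast
      then show ?case
        using step.IH wz connected_component_trans by blast
    qed
    then show ?thesis using v by blast
  qed
  have "connected_component ?D (p r) x" if x: "x \<in> ?D" for x
  proof (cases "x \<in> p ` C")
    case True
    then show ?thesis using vert by blast
  next
    case False
    then obtain u v where uv: "u \<in> C" "(u, v) \<in> parcs G" "x \<in> path_image (c {u, v})"
      "x \<notin> p ` (pverts G - C)"
      using x unfolding open_star_def by blast
    obtain T where T: "T = path_image (c {u, v}) - p ` (pverts G - C)"
      "Topological_Spaces.connected T" "p u \<in> T" "T \<subseteq> ?D"
      using open_star_half_edge[OF d G C(1) uv(1,2)] by blast
    then have "connected_component ?D (p u) x"
      using uv unfolding connected_component_def by blast
    then show ?thesis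
      using vert[OF uv(1)] connected_component_trans by blast
  qed
  then show ?thesis
    unfolding connected_iff_connected_component
    by (meson connected_component_sym connected_component_trans)
qed

lemma open_star_disjoint_edge:
  assumes d: "plane_drawing G p c" and G: "pair_graph G" and C: "C \<subseteq> pverts G"
    and e: "(w, z) \<in> parcs G" "w \<notin> C" "z \<notin> C"
  shows "open_star G p c C \<inter> path_image (c {w, z}) = {}"
proof -
  interpret pair_graph G by fact
  have wz: "w \<in> pverts G" "z \<in> pverts G"
    using e(1) by (auto dest: wellformed')
  have inj: "inj_on p (pverts G)"
    using d by (rule plane_drawingD)
  have V: "path_image (c {w, z}) \<inter> p ` pverts G \<subseteq> p ` (pverts G - C)"
    using plane_drawingD(4)[OF d e(1)] e wz by blast
  have "x \<in> p ` (pverts G - C)"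
    if uv: "(u, v) \<in> parcs G" "u \<in> C" and x: "x \<in> path_image (c {u, v})" "x \<in> path_image (c {w, z})"
    for u v x
  proof -
    have "{u, v} \<noteq> {w, z}" using uv e(2,3) by (metis insert_iff singletonD)
    then have "x \<in> p ` ({u, v} \<inter> {w, z})"
      using plane_drawing_edges_meet[OF d G uv(1) e(1)] x by blast
    then show ?thesis using e wz by blast
  qed
  moreover have "p ` C \<subseteq> p ` pverts G" using C by blast
  ultimately show ?thesis
    using V unfolding open_star_def by blast
qed

lemma plane_drawing_two_path:
  assumes d: "plane_drawing G p c" and G: "pair_graph G"
    and e: "(a, b) \<in> parcs G" "(b, a') \<in> parcs G" "a \<noteq> a'"
  obtains g where "Path_Connected.arc g" "pathstart g = p a" "pathfinish g = p a'"
    "path_image g = path_image (c {a, b}) \<union> path_image (c {b, a'})"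
proof -
  interpret pair_graph G by fact
  have ne: "a \<noteq> b" "b \<noteq> a'"
    using e(1,2) by (auto dest: no_loops')
  obtain g where g: "Path_Connected.arc g" "pathstart g = p a" "pathfinish g = p b"
    "path_image g = path_image (c {a, b})" "path_image g \<inter> p ` pverts G = {p a, p b}"
    using plane_drawing_edge[OF d e(1)] .
  obtain h where h: "Path_Connected.arc h" "pathstart h = p b" "pathfinish h = p a'"
    "path_image h = path_image (c {b, a'})" "path_image h \<inter> p ` pverts G = {p b, p a'}"
    using plane_drawing_edge[OF d e(2)] .
  have "{a, b} \<noteq> {b, a'}" and m: "{a, b} \<inter> {b, a'} = {b}"
    using ne e(3) by (auto simp: doubleton_eq_iff)
  then have "path_image g \<inter> path_image h = {p b}"
    using plane_drawing_edges_meet[OF d G e(1,2)] g(4) h(4) unfolding m by simp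
  then have "Path_Connected.arc (g +++ h)"
    using g h by (intro arc_join) auto
  then show thesis
    using that[of "g +++ h"] g h by (simp add: path_image_join)
qed

text \<open>
  In \<open>K\<^sub>3\<^sub>,\<^sub>3\<close> one side is \<open>B\<close>, the other consists of \<open>a\<close>, \<open>a'\<close> and the contracted set \<open>C\<close>. The paths
  \<open>a\<close>, \<open>b\<close>, \<open>a'\<close> with \<open>b \<in> B\<close> are drawn as a theta curve, and the open star of \<open>C\<close> is a connected
  set that reaches all three of its arcs.
\<close>

theorem no_plane_K33_model:
  assumes d: "plane_drawing G p c" and G: "pair_graph G"
    and C: "C \<subseteq> pverts G" "\<And>v. v \<in> C \<Longrightarrow> (r, v) \<in> (parcs G \<inter> C \<times> C)\<^sup>*"
    and a: "a \<noteq> a'" "a \<notin> C" "a' \<notin> C"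
    and B: "card B = 3" "B \<inter> C = {}"
    and e: "\<And>b. b \<in> B \<Longrightarrow> (a, b) \<in> parcs G \<and> (b, a') \<in> parcs G \<and> (\<exists>u \<in> C. (u, b) \<in> parcs G)"
  shows False
proof -
  interpret pair_graph G by fact
  let ?D = "open_star G p c C" and ?\<theta> = "\<lambda>b. path_image (c {a, b}) \<union> path_image (c {b, a'})"
  have inj: "inj_on p (pverts G)"
    using d by (rule plane_drawingD)
  have aB: "a \<notin> B" "a' \<notin> B"
    using e[of a] e[of a'] no_loops'[of a a] no_loops'[of a' a'] by auto
  have V: "a \<in> pverts G" "a' \<in> pverts G" "b \<in> pverts G" if "b \<in> B" for b
    using in_arcsD1[of a b] in_arcsD2[of a b] in_arcsD2[of b a'] e[OF that] by simp_all
  have "\<exists>g. Path_Connected.arc g \<and> pathstart g = p a \<and> pathfinish g = p a' \<and>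
    path_image g = ?\<theta> b" if "b \<in> B" for b
  proof -
    have "(a, b) \<in> parcs G" "(b, a') \<in> parcs G" using e[OF that] by simp_all
    from plane_drawing_two_path[OF d G this a(1)] show ?thesis by metis
  qed
  then obtain g where g: "\<And>b. b \<in> B \<Longrightarrow> Path_Connected.arc (g b) \<and> pathstart (g b) = p a \<and>
    pathfinish (g b) = p a' \<and> path_image (g b) = ?\<theta> b"
    by metis
  have meet: "path_image (g b) \<inter> path_image (g b') = {p a, p a'}"
    if b: "b \<in> B" "b' \<in> B" "b \<noteq> b'" for b b'
  proof -
    have E: "(a, b) \<in> parcs G" "(b, a') \<in> parcs G" "(a, b') \<in> parcs G" "(b', a') \<in> parcs G"
      using e[OF b(1)] e[OF b(2)] by simp_all
    have n: "b \<noteq> a" "b \<noteq> a'" "b' \<noteq> a" "b' \<noteq> a'" using b aB by blast+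
    note m = plane_drawing_edges_meet[OF d G]
    have "path_image (c {a, b}) \<inter> path_image (c {a, b'}) = p ` {a}"
      "path_image (c {a, b}) \<inter> path_image (c {b', a'}) = {}"
      "path_image (c {b, a'}) \<inter> path_image (c {a, b'}) = {}"
      "path_image (c {b, a'}) \<inter> path_image (c {b', a'}) = p ` {a'}"
      using m[OF E(1,3)] m[OF E(1,4)] m[OF E(2,3)] m[OF E(2,4)] n b(3) a(1)
      by (auto simp: doubleton_eq_iff)
    then show ?thesis
      using g[OF b(1)] g[OF b(2)] by auto
  qed
  have off: "?D \<inter> path_image (g b) = {}" if b: "b \<in> B" for b
  proof -
    have "b \<notin> C" using b B by blast
    then show ?thesis
      using open_star_disjoint_edge[OF d G C(1)] e[OF b] a g[OF b] by (simp add: Int_Un_distrib)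
  qed
  have b_in: "p b \<in> path_image (g b) - {p a, p a'}" "p b \<in> closure ?D" if b: "b \<in> B" for b
  proof -
    have "p b \<in> path_image (c {a, b})"
      using plane_drawingD(4)[OF d, of a b] e[OF b] by blast
    moreover have "p b \<noteq> p a" "p b \<noteq> p a'"
      using inj V[OF b] b aB by (auto simp: inj_on_def)
    ultimately show "p b \<in> path_image (g b) - {p a, p a'}"
      using g[OF b] by blast
    obtain u where "u \<in> C" "(u, b) \<in> parcs G" using e[OF b] by blast
    then obtain T where "T \<subseteq> ?D" "p b \<in> closure T"
      using open_star_half_edge[OF d G C(1)] by metis
    then show "p b \<in> closure ?D" using closure_mono by blast
  qed
  obtain x y z where xyz: "B = {x, y, z}" "x \<noteq> y" "y \<noteq> z" "x \<noteq> z"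
    using B(1) card_3_iff by metis
  then have xB: "x \<in> B" "y \<in> B" "z \<in> B" by auto
  have \<theta>: "theta_curve (p a) (p a') (g x) (g y) (g z)"
    unfolding theta_curve_def
    using g[OF xB(1)] g[OF xB(2)] g[OF xB(3)]
      meet[OF xB(1,2) xyz(2)] meet[OF xB(1,3) xyz(4)] meet[OF xB(2,3) xyz(3)] by simp
  show False
  proof (rule theta_curve_no_common_side[OF \<theta> connected_open_star[OF d G C]])
    show "?D \<inter> (path_image (g x) \<union> path_image (g y) \<union> path_image (g z)) = {}"
      using off xB by (simp add: Int_Un_distrib)
    show "{p x, p y, p z} \<subseteq> closure ?D"
      using b_in(2) xB by simp
  qed (assumption | (rule b_in(1), fact xB))+
qed

section \<open>Twins in planar 3-connected graphs\<close>

lemma k_connected_reachable: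
  assumes G: "pair_graph G" and k: "k_connected k G"
    and S: "S \<subseteq> pverts G" "card S < k" and uv: "u \<in> pverts G - S" "v \<in> pverts G - S"
  shows "(u, v) \<in> (parcs G \<inter> (pverts G - S) \<times> (pverts G - S))\<^sup>*"
proof -
  interpret pair_graph G by fact
  let ?M = "mk_symmetric (with_proj G \<restriction> (pverts G - S))"
  have "Digraph_Component.connected (with_proj G \<restriction> (pverts G - S))"
    using k S unfolding k_connected_def by blast
  then have "u \<rightarrow>\<^sup>*\<^bsub>with_proj ?M\<^esub> v"
    using uv unfolding Digraph_Component.connected_def strongly_connected_def
    by (auto simp: mk_symmetric_def)
  then have "(u, v) \<in> (arcs_ends (with_proj ?M))\<^sup>*"
    by (rule reachable_rtranclI)
  moreover have "arcs_ends (with_proj ?M) \<subseteq> parcs G \<inter> (pverts G - S) \<times> (pverts G - S)"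
    by (auto simp: mk_symmetric_def arcs_ends_def arc_to_ends_def induce_subgraph_def
        intro: arcs_symmetric)
  ultimately show ?thesis
    using rtrancl_mono by blast
qed

text \<open>
  Otherwise let \<open>C\<close> be the component of \<open>r\<close> after deleting the twins \<open>a\<close>, \<open>a'\<close> and their neighbours.
  Since \<open>C\<close> contains no neighbour of a twin, all edges leaving \<open>C\<close> end in common neighbours of the
  twins. The set \<open>N\<close> of these ends separates \<open>r\<close> from \<open>a\<close> and hence has at least three elements, so
  that \<open>a\<close>, \<open>a'\<close> and \<open>C\<close> form one side of a \<open>K\<^sub>3\<^sub>,\<^sub>3\<close> minor.
\<close>

theorem planar_3_connected_twins_dominate:
  assumes G: "pair_graph G" and pl: "planar G" and k: "k_connected 3 G"
    and a: "a \<in> pverts G" "a \<noteq> a'"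
    and twins: "\<And>v. (a, v) \<in> parcs G \<longleftrightarrow> (a', v) \<in> parcs G"
    and r: "r \<in> pverts G" "r \<noteq> a" "r \<noteq> a'"
  shows "(a, r) \<in> parcs G"
proof (rule ccontr)
  assume ar: "(a, r) \<notin> parcs G"
  interpret pair_graph G by fact
  define W where "W = {v \<in> pverts G. v \<noteq> a \<and> v \<noteq> a' \<and> (a, v) \<notin> parcs G}"
  define C where "C = {v. (r, v) \<in> (parcs G \<inter> W \<times> W)\<^sup>*}"
  define N where "N = {b. (a, b) \<in> parcs G \<and> (\<exists>u \<in> C. (u, b) \<in> parcs G)}"
  have rW: "r \<in> W" using r ar unfolding W_def by blast
  have CW: "C \<subseteq> W"
  proof
    fix v assume "v \<in> C"
    then have "(r, v) \<in> (parcs G \<inter> W \<times> W)\<^sup>*" unfolding C_def by blast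
    then show "v \<in> W" using rW by cases auto
  qed
  have step: "v \<in> C" if "u \<in> C" "(u, v) \<in> parcs G" "v \<in> W" for u v
    using that CW unfolding C_def by (auto intro: rtrancl_into_rtrancl)
  have conn: "(r, v) \<in> (parcs G \<inter> C \<times> C)\<^sup>*" if "v \<in> C" for v
  proof -
    have "(r, v) \<in> (parcs G \<inter> W \<times> W)\<^sup>*" using that unfolding C_def by blast
    then show ?thesis
    proof (induction rule: rtrancl_induct)
      case (step w z)
      then have "w \<in> C" "z \<in> C"
        unfolding C_def by (auto intro: rtrancl_into_rtrancl)
      then show ?case using step by (auto intro: rtrancl_into_rtrancl)
    qed simp
  qed
  have leave: "v \<in> C \<or> v \<in> N" if uv: "u \<in> C" "(u, v) \<in> parcs G" for u v
  proof (cases "v \<in> W")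
    case False
    have "(a, u) \<notin> parcs G" "(a', u) \<notin> parcs G"
      using uv CW twins unfolding W_def by blast+
    then have "v \<noteq> a" "v \<noteq> a'"
      using uv arcs_symmetric by blast+
    moreover have "v \<in> pverts G" using uv by (auto dest: wellformed')
    ultimately have "(a, v) \<in> parcs G"
      using False unfolding W_def by blast
    then show ?thesis using uv unfolding N_def by blast
  qed (use step uv in blast)
  have N: "N \<subseteq> pverts G" "a \<notin> N" "r \<notin> N"
    using ar unfolding N_def by (auto dest: wellformed' no_loops')
  have "3 \<le> card N"
  proof (rule ccontr)
    assume "\<not> 3 \<le> card N"
    then have "(r, a) \<in> (parcs G \<inter> (pverts G - N) \<times> (pverts G - N))\<^sup>*"
      using k_connected_reachable[OF G k N(1)] r a N by auto
    then have "a \<in> C"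
    proof (induction rule: rtrancl_induct)
      case base
      show ?case unfolding C_def by simp
    next
      case (step y z)
      then show ?case using leave by blast
    qed
    then show False using CW unfolding W_def by blast
  qed
  then obtain B where B: "B \<subseteq> N" "card B = 3"
    using obtain_subset_with_card_n by metis
  obtain p c where d: "plane_drawing G p c"
    using pl unfolding planar_def by blast
  show False
  proof (rule no_plane_K33_model[OF d G _ conn a(2) _ _ B(2)])
    show "C \<subseteq> pverts G" "a \<notin> C" "a' \<notin> C" using CW unfolding W_def by auto
    show "B \<inter> C = {}" using B(1) CW unfolding N_def W_def by blast
    show "(a, b) \<in> parcs G \<and> (b, a') \<in> parcs G \<and> (\<exists>u \<in> C. (u, b) \<in> parcs G)" if "b \<in> B" for b
      using that B(1) twins arcs_symmetric unfolding N_def by blast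
  qed
qed

theorem proposition1p1:
  fixes H :: "'a pair_pre_digraph"
  assumes "pair_graph H"
  shows "\<not> polytopal3 (H \<otimes>\<^sub>K path_graph 3)"
proof
  let ?G = "H \<otimes>\<^sub>K path_graph 3"
  interpret H: pair_graph H by fact
  assume "polytopal3 ?G"
  then have G: "planar ?G" "k_connected 3 ?G"
    unfolding polytopal3_def by auto
  then have "pverts ?G \<noteq> {}"
    unfolding k_connected_def by auto
  then obtain a where a: "a \<in> pverts H"
    by (auto simp: kronecker_def)
  \<comment> \<open>The twins over \<open>a\<close> force the edge from \<open>(a, 0)\<close> to \<open>(a, 1)\<close>, which would be a loop of \<open>H\<close> at \<open>a\<close>.\<close>
  have "((a, 0), (a, 1)) \<in> parcs ?G"
  proof (rule planar_3_connected_twins_dominate[OF _ G, where a' = "(a, 2)"])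
    show "pair_graph ?G"
      using assms pair_graph_path_graph by (rule pair_graph_kronecker)
    show "((a, 0), v) \<in> parcs ?G \<longleftrightarrow> ((a, 2), v) \<in> parcs ?G" for v
      by (cases v) (auto simp: kronecker_def path_graph_def)
  qed (use a in \<open>auto simp: kronecker_def path_graph_def\<close>)
  then show False
    by (auto simp: kronecker_def dest: H.no_loops')
qed

end
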